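(* Let $\Omega\subset\mathbb{H}^1$ be a bounded domain, $\varepsilon>0$ and $\phi\in L^1(\Omega)$. Then $$\int_{\Omega_\varepsilon}\phi\,dx=\frac1{|Y|}\int_{\Omega\times Y}T^\varepsilon(\phi)\,dx\,dy.$$
   Context: $\mathbb{H}^1$ is $\mathbb{R}^3$ with the group law $p\cdot q=(p_1+q_1,p_2+q_2,p_3+q_3+2(p_2q_1-p_1q_2))$, dilations $\delta_\lambda(x)=(\lambda x_1,\lambda x_2,\lambda^2x_3)$ for $\lambda>0$, and Lebesgue measure $|\cdot|$. $Y=[0,2)^3$. For $k\in\mathbb{Z}^3$, $2k=(2k_1,2k_2,2k_3)$. For $\varepsilon>0$ the sets $Y^\varepsilon_k=\delta_\varepsilon(2k\cdot Y)$, $k\in\mathbb{Z}^3$, tile $\mathbb{H}^1$ (they are disjoint and cover it). For $x\in\mathbb{H}^1$, $[\delta_{1/\varepsilon}x]_{\mathbb{H}}\in\mathbb{Z}^3$ is the unique $k$ with $x\in Y^\varepsilon_k$. Let $E_\varepsilon=\{k\in\mathbb{Z}^3:Y^\varepsilon_k\subset\Omega\}$, $\Omega_\varepsilon=\bigcup_{k\in E_\varepsilon}Y^\varepsilon_k$, $\Lambda_\varepsilon=\Omega\setminus\Omega_\varepsilon$. The unfolding of $\phi:\Omega\to\mathbb{R}$ is $T^\varepsilon(\phi):\Omega\times Y\to\mathbb{R}$, with $T^\varepsilon(\phi)(x,y)=\phi\big(\delta_\varepsilon(2[\delta_{1/\varepsilon}x]_{\mathbb{H}})\cdot\delta_\varepsilon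 y\big)$ for $(x,y)\in\Omega_\varepsilon\times Y$ and $T^\varepsilon(\phi)(x,y)=0$ for $(x,y)\in\Lambda_\varepsilon\times Y$. *)

theory Defs
  imports "HOL-Analysis.Analysis"
begin

definition hmul :: "real^3 \<Rightarrow> real^3 \<Rightarrow> real^3"  (infixl "\<cdot>\<^sub>H" 70) where
  "p \<cdot>\<^sub>H q = vector [p$1 + q$1, p$2 + q$2, p$3 + q$3 + 2 * (p$2 * q$1 - p$1 * q$2)]"

definition hdil :: "real \<Rightarrow> real^3 \<Rightarrow> real^3" where
  "hdil l x = vector [l * x$1, l * x$2, l\<^sup>2 * x$3]"

definition refcell :: "(real^3) set" where
  "refcell = {y. \<forall>i. 0 \<le> y$i \<and> y$i < 2}"

definition twice :: "int^3 \<Rightarrow> real^3" where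
  "twice k = (\<chi> i. 2 * real_of_int (k$i))"

definition cell :: "real \<Rightarrow> int^3 \<Rightarrow> (real^3) set" where
  "cell \<epsilon> k = hdil \<epsilon> ` ((\<lambda>y. twice k \<cdot>\<^sub>H y) ` refcell)"

text \<open>\<^term>\<open>cell_index \<epsilon> x\<close> stands for $[\delta_{1/\varepsilon}x]_{\mathbb{H}}$; it is
  well defined for $\varepsilon>0$ by the tiling property \<open>ex1_cell\<close> below.\<close>

definition cell_index :: "real \<Rightarrow> real^3 \<Rightarrow> int^3" where
  "cell_index \<epsilon> x = (THE k. x \<in> cell \<epsilon> k)"

definition inner_cells :: "(real^3) set \<Rightarrow> real \<Rightarrow> (int^3) set" where
  "inner_cells \<Omega> \<epsilon> = {k. cell \<epsilon> k \<subseteq> \<Omega>}"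

definition inner_part :: "(real^3) set \<Rightarrow> real \<Rightarrow> (real^3) set" where
  "inner_part \<Omega> \<epsilon> = (\<Union>k\<in>inner_cells \<Omega> \<epsilon>. cell \<epsilon> k)"

text \<open>Only the values on $\Omega\times Y$ matter; the \<open>else\<close> branch is the value on
  $\Lambda_\varepsilon\times Y$ with $\Lambda_\varepsilon=\Omega\setminus\Omega_\varepsilon$.\<close>

definition unfolding_op :: "(real^3) set \<Rightarrow> real \<Rightarrow> (real^3 \<Rightarrow> real) \<Rightarrow> (real^3) \<times> (real^3) \<Rightarrow> real" where
  "unfolding_op \<Omega> \<epsilon> \<phi> = (\<lambda>(x, y).
     if x \<in> inner_part \<Omega> \<epsilon> then \<phi> (hdil \<epsilon> (twice (cell_index \<epsilon> x)) \<cdot>\<^sub>H hdil \<epsilon> y) else 0)"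

lemma mem_cell_iff:
  assumes "\<epsilon> > 0"
  shows "x \<in> cell \<epsilon> k \<longleftrightarrow>
    k$1 = \<lfloor>x$1 / \<epsilon> / 2\<rfloor> \<and> k$2 = \<lfloor>x$2 / \<epsilon> / 2\<rfloor> \<and>
    k$3 = \<lfloor>(x$3 / \<epsilon>\<^sup>2 - 4 * (of_int (k$2) * (x$1 / \<epsilon>) - of_int (k$1) * (x$2 / \<epsilon>))) / 2\<rfloor>"
    (is "_ \<longleftrightarrow> ?R")
proof -
  let ?y = "vector [x$1 / \<epsilon> - 2 * of_int (k$1), x$2 / \<epsilon> - 2 * of_int (k$2),
     x$3 / \<epsilon>\<^sup>2 - 2 * of_int (k$3) - 4 * (of_int (k$2) * (x$1 / \<epsilon>) - of_int (k$1) * (x$2 / \<epsilon>))] :: real^3"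
  have eq: "x = hdil \<epsilon> (twice k \<cdot>\<^sub>H y) \<longleftrightarrow> y = ?y" for y
  proof
    assume *: "x = hdil \<epsilon> (twice k \<cdot>\<^sub>H y)"
    show "y = ?y"
      using assms unfolding * vec_eq_iff forall_3
      by (simp add: hdil_def hmul_def twice_def vector_3 field_simps power2_eq_square)
  next
    assume *: "y = ?y"
    show "x = hdil \<epsilon> (twice k \<cdot>\<^sub>H y)"
      using assms unfolding * vec_eq_iff forall_3
      by (simp add: hdil_def hmul_def twice_def vector_3 field_simps power2_eq_square)
  qed
  have "x \<in> cell \<epsilon> k \<longleftrightarrow> (\<exists>y\<in>refcell. x = hdil \<epsilon> (twice k \<cdot>\<^sub>H y))"
    by (auto simp: cell_def)
  also have "\<dots> \<longleftrightarrow> ?y \<in> refcell"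
    unfolding eq by blast
  also have "\<dots> \<longleftrightarrow> ?R"
  proof -
    have fl: "n = \<lfloor>a / 2\<rfloor> \<longleftrightarrow> 0 \<le> a - 2 * of_int n \<and> a - 2 * of_int n < 2" for n :: int and a :: real
      by (subst eq_commute) (auto simp: floor_eq_iff)
    show ?thesis
      unfolding fl refcell_def mem_Collect_eq forall_3
      by (auto simp: vector_3)
  qed
  finally show ?thesis .
qed

lemma ex1_cell:
  assumes "\<epsilon> > 0"
  shows "\<exists>!k. x \<in> cell \<epsilon> k"
proof -
  let ?a = "\<lfloor>x$1 / \<epsilon> / 2\<rfloor>" and ?b = "\<lfloor>x$2 / \<epsilon> / 2\<rfloor>"
  let ?k = "vector [?a, ?b,
    \<lfloor>(x$3 / \<epsilon>\<^sup>2 - 4 * (of_int ?b * (x$1 / \<epsilon>) - of_int ?a * (x$2 / \<epsilon>))) / 2\<rfloor>] :: int^3"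
  show ?thesis
  proof (rule ex1I[of _ ?k])
    show "x \<in> cell \<epsilon> ?k"
      unfolding mem_cell_iff[OF assms] by (simp only: vector_3 simp_thms)
  next
    fix k assume "x \<in> cell \<epsilon> k"
    then show "k = ?k"
      unfolding mem_cell_iff[OF assms] vec_eq_iff forall_3 vector_3 by (elim conjE) simp
  qed
qed

end

theory Submission
  imports Defs
begin

text \<open>
  The map \<open>y \<mapsto> \<delta>\<^sub>\<epsilon>(2k) \<cdot> \<delta>\<^sub>\<epsilon> y\<close> from \<open>Y\<close> onto the cell \<open>Y\<^sup>\<epsilon>\<^sub>k\<close> is affine with
  determinant \<open>\<epsilon>\<^sup>4\<close>. On \<open>Y\<^sup>\<epsilon>\<^sub>k \<times> Y\<close> the unfolded function depends on \<open>y\<close> only, so its integral is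
  \<open>\<bar>Y\<^sup>\<epsilon>\<^sub>k\<bar> = \<epsilon>\<^sup>4 \<bar>Y\<bar>\<close> times the integral over \<open>Y\<close> of the pulled-back function, which is \<open>\<bar>Y\<bar>\<close>
  times the integral of \<open>\<phi>\<close> over the cell. All cells have the same positive volume, so only
  finitely many fit into the bounded set \<open>\<Omega>\<close>, and these contributions add up.
\<close>

section \<open>Change of variables for real-valued integrands\<close>

lemma change_of_variables_real_valued:
  fixes f :: "real^'m::{finite,wellorder} \<Rightarrow> real" and g :: "real^'m::_ \<Rightarrow> real^'m::_"
  assumes S: "S \<in> sets lebesgue"
    and der_g: "\<And>x. x \<in> S \<Longrightarrow> (g has_derivative g' x) (at x within S)"
    and inj: "inj_on g S"
    and f: "f absolutely_integrable_on (g ` S)"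
  shows absolutely_integrable_change_of_variables_real_valued:
      "(\<lambda>x. \<bar>det (matrix (g' x))\<bar> * f (g x)) absolutely_integrable_on S"
    and integral_change_of_variables_real_valued:
      "integral S (\<lambda>x. \<bar>det (matrix (g' x))\<bar> * f (g x)) = integral (g ` S) f"
proof -
  have "(\<lambda>x. \<bar>det (matrix (g' x))\<bar> *\<^sub>R vec (f (g x)) :: real^1) absolutely_integrable_on S \<and>
      integral S (\<lambda>x. \<bar>det (matrix (g' x))\<bar> *\<^sub>R vec (f (g x))) = (vec (integral (g ` S) f) :: real^1)
    \<longleftrightarrow> (\<lambda>x. vec (f x) :: real^1) absolutely_integrable_on (g ` S) \<and>
      integral (g ` S) (\<lambda>x. vec (f x)) = (vec (integral (g ` S) f) :: real^1)"
    by (rule has_absolute_integral_change_of_variables[OF S der_g inj])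
  then have "(\<lambda>x. \<bar>det (matrix (g' x))\<bar> * f (g x)) absolutely_integrable_on S \<and>
      integral S (\<lambda>x. \<bar>det (matrix (g' x))\<bar> * f (g x)) = integral (g ` S) f"
    using f by (simp add: absolutely_integrable_on_1_iff integral_on_1_eq)
  then show "(\<lambda>x. \<bar>det (matrix (g' x))\<bar> * f (g x)) absolutely_integrable_on S"
    "integral S (\<lambda>x. \<bar>det (matrix (g' x))\<bar> * f (g x)) = integral (g ` S) f"
    by blast+
qed

section \<open>Product integrals for the completed measure\<close>

text \<open>The exceptional set of \<open>P\<close> may fail to be Borel, so it is enlarged to a
  Borel null set \<open>N\<close>; the cylinder over \<open>N\<close> is null by slicing.\<close>

lemma AE_lborel_pair_fst:
  assumes "AE x in lborel. P x"
  shows "AE z in lborel \<Otimes>\<^sub>M (lborel :: 'b::euclidean_space measure). P (fst z)"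
proof -
  obtain N where N: "{x \<in> space lborel. \<not> P x} \<subseteq> N" "N \<in> null_sets lborel"
    using assms by (auto elim!: AE_E simp: null_sets_def)
  then have [measurable]: "N \<in> sets lborel"
    by auto
  have "AE z in lborel \<Otimes>\<^sub>M (lborel :: 'b::euclidean_space measure). fst z \<notin> N"
  proof (rule lborel_pair.AE_pair_measure)
    show "{z \<in> space (lborel \<Otimes>\<^sub>M (lborel :: 'b::euclidean_space measure)). fst z \<notin> N} \<in> sets (lborel \<Otimes>\<^sub>M (lborel :: 'b::euclidean_space measure))"
      by measurable
    show "AE x in lborel. AE y in lborel. fst (x, y) \<notin> N"
      using AE_not_in[OF N(2)] by eventually_elim simp
  qed
  then show ?thesis
    by eventually_elim (use N(1) in auto)
qed

lemma AE_lborel_pair_snd: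
  assumes "AE x in lborel. P x"
  shows "AE z in (lborel :: 'a::euclidean_space measure) \<Otimes>\<^sub>M lborel. P (snd z)"
proof -
  obtain N where N: "{x \<in> space lborel. \<not> P x} \<subseteq> N" "N \<in> null_sets lborel"
    using assms by (auto elim!: AE_E simp: null_sets_def)
  then have [measurable]: "N \<in> sets lborel"
    by auto
  have "AE z in (lborel :: 'a::euclidean_space measure) \<Otimes>\<^sub>M lborel. snd z \<notin> N"
  proof (rule lborel_pair.AE_pair_measure)
    show "{z \<in> space ((lborel :: 'a::euclidean_space measure) \<Otimes>\<^sub>M lborel). snd z \<notin> N} \<in> sets ((lborel :: 'a::euclidean_space measure) \<Otimes>\<^sub>M lborel)"
      by measurable
    show "AE x in lborel. AE y in lborel. snd (x, y) \<notin> N"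
      using AE_not_in[OF N(2)] by simp
  qed
  then show ?thesis
    by eventually_elim (use N(1) in auto)
qed

text \<open>\<open>lebesgue\<close> on the product type is the completion of the Borel product
  measure, not a product of completions, so Fubini does not apply to it directly. Both factors are
  replaced by Borel functions equal to them almost everywhere, Fubini is applied to those, and the
  result is carried back.\<close>

lemma
  fixes f :: "'a::euclidean_space \<Rightarrow> real" and g :: "'b::euclidean_space \<Rightarrow> real"
  assumes f: "integrable lebesgue f" and g: "integrable lebesgue g"
  shows integrable_lebesgue_times: "integrable lebesgue (\<lambda>(x, y). f x * g y)"
    and integral_lebesgue_times:
      "(\<integral>z. (case z of (x, y) \<Rightarrow> f x * g y) \<partial>lebesgue) = (\<integral>x. f x \<partial>lebesgue) * (\<integral>y. g y \<partial>lebesgue)"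
proof -
  obtain f' where f': "f' \<in> borel_measurable lborel" "AE x in lborel. f x = f' x"
    using completion_ex_borel_measurable_real[of f lborel] f by auto
  obtain g' where g': "g' \<in> borel_measurable lborel" "AE x in lborel. g x = g' x"
    using completion_ex_borel_measurable_real[of g lborel] g by auto
  note [measurable] = f'(1) g'(1)
  have f'': "f' \<in> borel_measurable lebesgue" and g'': "g' \<in> borel_measurable lebesgue"
    using f'(1) g'(1) by (auto intro: measurable_completion)
  have "integrable lebesgue f'" and If: "(\<integral>x. f x \<partial>lebesgue) = (\<integral>x. f' x \<partial>lebesgue)"
    using f f'' AE_completion[OF f'(2)] integrable_cong_AE[of f lebesgue f'] integral_cong_AE[of f lebesgue f']
    by auto
  then have f'i: "integrable lborel f'"
    using integrable_completion f'(1) by blast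
  have "integrable lebesgue g'" and Ig: "(\<integral>x. g x \<partial>lebesgue) = (\<integral>x. g' x \<partial>lebesgue)"
    using g g'' AE_completion[OF g'(2)] integrable_cong_AE[of g lebesgue g'] integral_cong_AE[of g lebesgue g']
    by auto
  then have g'i: "integrable lborel g'"
    using integrable_completion g'(1) by blast
  let ?h = "\<lambda>(x, y). f x * g y" and ?h' = "\<lambda>(x, y). f' x * g' y"
  have h'm: "?h' \<in> borel_measurable (lborel \<Otimes>\<^sub>M lborel)"
    by measurable
  have h'i: "integrable (lborel \<Otimes>\<^sub>M lborel) ?h'"
  proof (rule lborel_pair.Fubini_integrable[OF h'm])
    show "integrable lborel (\<lambda>x. \<integral>y. norm (case (x, y) of (x, y) \<Rightarrow> f' x * g' y) \<partial>lborel)"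
      using f'i by (simp add: abs_mult)
    show "AE x in lborel. integrable lborel (\<lambda>y. case (x, y) of (x, y) \<Rightarrow> f' x * g' y)"
      using g'i by simp
  qed
  have "AE z in lborel \<Otimes>\<^sub>M lborel. f (fst z) = f' (fst z)"
    using f'(2) by (rule AE_lborel_pair_fst)
  moreover have "AE z in lborel \<Otimes>\<^sub>M lborel. g (snd z) = g' (snd z)"
    using g'(2) by (rule AE_lborel_pair_snd)
  ultimately have "AE z in lborel \<Otimes>\<^sub>M lborel. ?h' z = ?h z"
    by eventually_elim auto
  then have ae: "AE z in lebesgue. ?h' z = ?h z"
    unfolding lborel_prod by (rule AE_completion)
  have h'l: "integrable lebesgue ?h'"
    using h'i h'm unfolding lborel_prod by (simp add: integrable_completion)
  \<comment> \<open>Completeness of the measure: \<open>?h\<close> differs from a measurable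
    function only on a null set.\<close>
  have hm: "?h \<in> borel_measurable lebesgue"
    by (rule borel_measurable_AE[OF _ ae]) (use h'l in auto)
  show "integrable lebesgue ?h"
    using h'l ae hm integrable_cong_AE[of ?h lebesgue ?h'] by (auto simp: eq_commute)
  have "integral\<^sup>L lebesgue ?h = integral\<^sup>L lebesgue ?h'"
    using h'l ae hm by (intro integral_cong_AE) (auto simp: eq_commute)
  also have "\<dots> = integral\<^sup>L (lborel \<Otimes>\<^sub>M lborel) ?h'"
    using h'm unfolding lborel_prod by (simp add: integral_completion)
  also have "\<dots> = (\<integral>x. \<integral>y. f' x * g' y \<partial>lborel \<partial>lborel)"
    using lborel_pair.integral_fst'[OF h'i] by simp
  also have "\<dots> = integral\<^sup>L lborel f' * integral\<^sup>L lborel g'"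
    by simp
  also have "\<dots> = integral\<^sup>L lebesgue f * integral\<^sup>L lebesgue g"
    using If Ig f'(1) g'(1) by (simp add: integral_completion)
  finally show "integral\<^sup>L lebesgue ?h = integral\<^sup>L lebesgue f * integral\<^sup>L lebesgue g" .
qed

section \<open>The affine chart of a cell\<close>

definition cell_chart :: "real \<Rightarrow> int^3 \<Rightarrow> real^3 \<Rightarrow> real^3" where
  "cell_chart \<epsilon> k y = hdil \<epsilon> (twice k) \<cdot>\<^sub>H hdil \<epsilon> y"

text \<open>The linear part of the chart. The off-diagonal entries are the twist
  \<open>2 * (p$2 * q$1 - p$1 * q$2)\<close> of the group law at
  \<open>p = hdil \<epsilon> (twice k)\<close> and \<open>q = hdil \<epsilon> y\<close>.\<close>

definition cell_chart_matrix :: "real \<Rightarrow> int^3 \<Rightarrow> real^3^3" where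
  "cell_chart_matrix \<epsilon> k = vector [vector [\<epsilon>, 0, 0], vector [0, \<epsilon>, 0],
     vector [4 * \<epsilon>\<^sup>2 * of_int (k$2), - 4 * \<epsilon>\<^sup>2 * of_int (k$1), \<epsilon>\<^sup>2]]"

text \<open>Dilations are group homomorphisms, so dilating the product equals multiplying the
  dilated factors, which is the form used by \<open>unfolding_op\<close>.\<close>

lemma cell_eq_chart_image: "cell \<epsilon> k = cell_chart \<epsilon> k ` refcell"
proof -
  have "hdil \<epsilon> (twice k \<cdot>\<^sub>H y) = cell_chart \<epsilon> k y" for y
    by (simp add: cell_chart_def vec_eq_iff forall_3 hdil_def hmul_def field_simps power2_eq_square)
  then show ?thesis
    by (simp add: cell_def image_image)
qed

lemma cell_chart_affine: "cell_chart \<epsilon> k y = hdil \<epsilon> (twice k) + cell_chart_matrix \<epsilon> k *v y"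
  by (simp add: cell_chart_def cell_chart_matrix_def vec_eq_iff forall_3 hdil_def hmul_def twice_def
      matrix_vector_mult_def sum_3 field_simps power2_eq_square)

text \<open>The matrix is lower triangular with diagonal \<epsilon>, \<epsilon>, \<epsilon> squared;
  the twist does not affect volume.\<close>

lemma det_cell_chart_matrix: "det (cell_chart_matrix \<epsilon> k) = \<epsilon> ^ 4"
  by (simp add: det_3 cell_chart_matrix_def power2_eq_square power4_eq_xxxx)

lemma has_derivative_cell_chart:
  "(cell_chart \<epsilon> k has_derivative (*v) (cell_chart_matrix \<epsilon> k)) (at y within S)"
proof -
  have "((\<lambda>y. hdil \<epsilon> (twice k) + cell_chart_matrix \<epsilon> k *v y) has_derivative
      (*v) (cell_chart_matrix \<epsilon> k)) (at y within S)"
    by (auto intro!: derivative_eq_intros bounded_linear_imp_has_derivative)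
  then show ?thesis
    by (simp add: cell_chart_affine[abs_def])
qed

lemma inj_cell_chart:
  assumes "\<epsilon> > 0"
  shows "inj (cell_chart \<epsilon> k)"
proof -
  have "inj ((*v) (cell_chart_matrix \<epsilon> k))"
    using assms by (simp add: inj_matrix_vector_mult invertible_det_nz det_cell_chart_matrix)
  then show ?thesis
    by (auto simp: inj_def cell_chart_affine)
qed

section \<open>Measurability and positive volume of the reference cell\<close>

lemma refcell_borel: "refcell \<in> sets borel"
proof -
  have "refcell = (\<Inter>i. {y. 0 \<le> y$i} \<inter> {y. y$i < 2})"
    by (auto simp: refcell_def)
  also have "\<dots> \<in> sets borel"
    by (intro sets.countable_INT'' sets.Int borel_closed borel_open closed_halfspace_component_ge_cart
        closed_Collect_le open_Collect_less continuous_intros) auto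
  finally show ?thesis .
qed

lemma refcell_lmeasurable: "refcell \<in> lmeasurable"
proof (rule bounded_set_imp_lmeasurable)
  have "refcell \<subseteq> cbox 0 (vec 2)"
    by (auto simp: refcell_def mem_box_cart less_imp_le)
  then show "bounded refcell"
    using bounded_cbox bounded_subset by blast
  show "refcell \<in> sets lebesgue"
    using refcell_borel by simp
qed

lemma measure_refcell_pos: "measure lebesgue refcell > 0"
proof -
  have "box 0 (vec 2) \<subseteq> refcell"
    by (auto simp: refcell_def mem_box_cart less_imp_le)
  then have "measure lebesgue (box 0 (vec 2 :: real^3)) \<le> measure lebesgue refcell"
    by (intro measure_mono_fmeasurable refcell_lmeasurable) auto
  moreover have "measure lebesgue (box 0 (vec 2 :: real^3)) > 0"
    by (auto simp: measure_lborel_box_eq Basis_vec_def inner_axis intro!: prod_pos)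
  ultimately show ?thesis
    by simp
qed

section \<open>Integrals over cells and volumes of cells\<close>

lemma
  assumes "\<epsilon> > 0" and \<phi>: "set_integrable lebesgue (cell \<epsilon> k) \<phi>"
  shows set_integrable_refcell_chart: "set_integrable lebesgue refcell (\<lambda>y. \<phi> (cell_chart \<epsilon> k y))"
    and set_integral_cell_eq: "(LINT x:cell \<epsilon> k|lebesgue. \<phi> x) =
      \<epsilon> ^ 4 * (LINT y:refcell|lebesgue. \<phi> (cell_chart \<epsilon> k y))"
proof -
  note cov = change_of_variables_real_valued[of refcell "cell_chart \<epsilon> k"
      "\<lambda>_. (*v) (cell_chart_matrix \<epsilon> k)" \<phi>, folded cell_eq_chart_image,
      OF fmeasurableD[OF refcell_lmeasurable] has_derivative_cell_chart
      inj_on_subset[OF inj_cell_chart[OF \<open>\<epsilon> > 0\<close>] subset_UNIV] \<phi>,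
      unfolded matrix_of_matrix_vector_mul det_cell_chart_matrix]
  \<comment> \<open>The Jacobian is a nonzero constant, so it can be divided out of the
    integrand.\<close>
  have "set_integrable lebesgue refcell (\<lambda>y. inverse (\<epsilon> ^ 4) * (\<bar>\<epsilon> ^ 4\<bar> * \<phi> (cell_chart \<epsilon> k y)))"
    by (rule set_integrable_mult_right[OF cov(1)])
  then show *: "set_integrable lebesgue refcell (\<lambda>y. \<phi> (cell_chart \<epsilon> k y))"
    using \<open>\<epsilon> > 0\<close> by (simp add: mult.assoc[symmetric])
  show "(LINT x:cell \<epsilon> k|lebesgue. \<phi> x) =
      \<epsilon> ^ 4 * (LINT y:refcell|lebesgue. \<phi> (cell_chart \<epsilon> k y))"
    using cov(2) \<open>\<epsilon> > 0\<close> by (simp add: set_lebesgue_integral_eq_integral(2)[OF \<phi>]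
      set_lebesgue_integral_eq_integral(2)[OF *])
qed

lemma
  shows cell_lmeasurable: "cell \<epsilon> k \<in> lmeasurable"
    and measure_cell: "measure lebesgue (cell \<epsilon> k) = \<epsilon> ^ 4 * measure lebesgue refcell"
proof -
  have eq: "cell \<epsilon> k = (+) (hdil \<epsilon> (twice k)) ` (*v) (cell_chart_matrix \<epsilon> k) ` refcell"
    by (simp add: cell_eq_chart_image cell_chart_affine image_image)
  show "cell \<epsilon> k \<in> lmeasurable"
    unfolding eq by (intro measurable_translation measurable_linear_image refcell_lmeasurable) simp
  show "measure lebesgue (cell \<epsilon> k) = \<epsilon> ^ 4 * measure lebesgue refcell"
    unfolding eq
    by (simp add: measure_translation measure_linear_image refcell_lmeasurable det_cell_chart_matrix)
qed

section \<open>Disjointness and number of cells\<close>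

lemma disjoint_family_cell:
  assumes "\<epsilon> > 0"
  shows "disjoint_family (cell \<epsilon>)"
  using ex1_cell[OF assms] by (fastforce simp: disjoint_family_on_def)

lemma cell_index_eq:
  assumes "\<epsilon> > 0" "x \<in> cell \<epsilon> k"
  shows "cell_index \<epsilon> x = k"
  unfolding cell_index_def by (rule the1_equality[OF ex1_cell[OF assms(1)] assms(2)])

text \<open>A packing argument: disjoint cells of common volume \<open>?c\<close> fit into a set of
  finite measure at most \<open>measure lebesgue \<Omega> / ?c\<close> times. The bound is proved
  for finite subfamilies, uniformly, which forces the whole family to be finite.\<close>

lemma finite_inner_cells:
  assumes "\<Omega> \<in> lmeasurable" "\<epsilon> > 0"
  shows "finite (inner_cells \<Omega> \<epsilon>)"
proof -
  let ?c = "\<epsilon> ^ 4 * measure lebesgue refcell"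
  have c: "?c > 0"
    using assms(2) measure_refcell_pos by simp
  have "card F \<le> nat \<lceil>measure lebesgue \<Omega> / ?c\<rceil>"
    if "F \<subseteq> inner_cells \<Omega> \<epsilon>" "finite F" for F
  proof -
    have "real (card F) * ?c = (\<Sum>k\<in>F. measure lebesgue (cell \<epsilon> k))"
      by (simp add: measure_cell)
    also have "\<dots> = measure lebesgue (\<Union>k\<in>F. cell \<epsilon> k)"
      using that cell_lmeasurable disjoint_family_cell[OF assms(2)]
      by (intro measure_UNION'[symmetric]) (auto simp: disjoint_family_on_def pairwise_def disjnt_def)
    also have "\<dots> \<le> measure lebesgue \<Omega>"
      using that assms cell_lmeasurable
      by (intro measure_mono_fmeasurable) (auto simp: inner_cells_def intro!: sets.finite_UN)
    finally have "real (card F) \<le> measure lebesgue \<Omega> / ?c"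
      using c by (simp add: field_simps)
    then show ?thesis
      by linarith
  qed
  then show ?thesis
    by (intro finite_if_finite_subsets_card_bdd[THEN conjunct1]) blast
qed

section \<open>Summation over the inner cells\<close>

theorem proposition9:
  fixes \<Omega> :: "(real^3) set" and \<epsilon> :: real and \<phi> :: "real^3 \<Rightarrow> real"
  assumes "open \<Omega>" and "connected \<Omega>" and "bounded \<Omega>"
    and "\<epsilon> > 0"
    and "integrable (lebesgue_on \<Omega>) \<phi>"
  shows "integrable (lebesgue_on (\<Omega> \<times> refcell)) (unfolding_op \<Omega> \<epsilon> \<phi>) \<and>
    (\<integral>x. \<phi> x \<partial>lebesgue_on (inner_part \<Omega> \<epsilon>)) =
      1 / measure lebesgue refcell *
        (\<integral>z. unfolding_op \<Omega> \<epsilon> \<phi> z \<partial>lebesgue_on (\<Omega> \<times> refcell))"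
proof -
  let ?E = "inner_cells \<Omega> \<epsilon>"
  let ?g = "\<lambda>k y. indicator refcell y * \<phi> (cell_chart \<epsilon> k y)"
  \<comment> \<open>The contribution of cell \<open>k\<close> to the unfolded function. The
    variables separate because the cell index is constant for \<open>x\<close> in the cell.\<close>
  let ?F = "\<lambda>k (x, y). indicat_real (cell \<epsilon> k) x * ?g k y"
  have \<Omega>: "\<Omega> \<in> lmeasurable"
    using assms by (simp add: lmeasurable_open)
  have E: "finite ?E"
    using finite_inner_cells[OF \<Omega> \<open>\<epsilon> > 0\<close>] .
  have \<phi>: "set_integrable lebesgue \<Omega> \<phi>"
    using assms \<Omega> by (simp add: set_integrable_def integrable_restrict_space)
  have \<phi>k: "set_integrable lebesgue (cell \<epsilon> k) \<phi>" if "k \<in> ?E" for k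
    using that cell_lmeasurable by (intro set_integrable_subset[OF \<phi>]) (auto simp: inner_cells_def)
  have cell_int: "integrable lebesgue (indicat_real (cell \<epsilon> k))" for k
    using cell_lmeasurable[of \<epsilon> k] by (simp add: lmeasurable_iff_integrable)
  have g_int: "integrable lebesgue (?g k)" if "k \<in> ?E" for k
    using set_integrable_refcell_chart[OF \<open>\<epsilon> > 0\<close> \<phi>k[OF that]] by (simp add: set_integrable_def)
  have F_int: "integrable lebesgue (?F k)" if "k \<in> ?E" for k
    by (rule integrable_lebesgue_times[OF cell_int g_int[OF that]])
  \<comment> \<open>The integral over \<open>x\<close> gives the cell volume, \<epsilon> to the
    fourth times the volume of \<open>refcell\<close>; that power of \<epsilon> is exactly the
    Jacobian turning the integral of \<open>?g k\<close> into the integral of \<phi> over the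
    cell.\<close>
  have F_integral: "integral\<^sup>L lebesgue (?F k) = measure lebesgue refcell * (LINT x:cell \<epsilon> k|lebesgue. \<phi> x)"
    if "k \<in> ?E" for k
  proof -
    have "integral\<^sup>L lebesgue (?F k) = measure lebesgue (cell \<epsilon> k) * integral\<^sup>L lebesgue (?g k)"
      using cell_lmeasurable by (simp add: integral_lebesgue_times[OF cell_int g_int[OF that]])
    then show ?thesis
      using set_integral_cell_eq[OF \<open>\<epsilon> > 0\<close> \<phi>k[OF that]]
      by (simp add: measure_cell set_lebesgue_integral_def)
  qed
  have pm: "\<Omega> \<times> refcell \<in> sets lebesgue"
  proof -
    have "\<Omega> \<times> refcell \<in> sets (borel \<Otimes>\<^sub>M borel)"
      using \<open>open \<Omega>\<close> refcell_borel by (intro pair_measureI) auto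
    then show ?thesis
      unfolding borel_prod by simp
  qed
  \<comment> \<open>An identity at every point, so integrability and the integral of the unfolded
    function both reduce to a finite sum. By uniqueness of the index at most one summand is nonzero,
    and an inner cell lies in \<Omega>, so the indicator of \<Omega> is 1 there.\<close>
  have unfold: "indicat_real (\<Omega> \<times> refcell) z * unfolding_op \<Omega> \<epsilon> \<phi> z = (\<Sum>k\<in>?E. ?F k z)" for z
  proof (cases z)
    case (Pair x y)
    show ?thesis
    proof (cases "x \<in> inner_part \<Omega> \<epsilon>")
      case True
      then obtain k where k: "k \<in> ?E" "x \<in> cell \<epsilon> k"
        by (auto simp: inner_part_def)
      have "x \<notin> cell \<epsilon> j" if "j \<noteq> k" for j
        using cell_index_eq[OF \<open>\<epsilon> > 0\<close>] k(2) that by metis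
      then have "(\<Sum>j\<in>?E. ?F j z) = (\<Sum>j\<in>?E. if j = k then ?F k z else 0)"
        using Pair by (intro sum.cong) auto
      also have "\<dots> = ?F k z"
        using E k by simp
      finally show ?thesis
        using True k Pair cell_index_eq[OF \<open>\<epsilon> > 0\<close> k(2)]
        by (auto simp: unfolding_op_def inner_cells_def cell_chart_def indicator_def)
    next
      case False
      then have "(\<Sum>k\<in>?E. ?F k z) = 0"
        using Pair by (intro sum.neutral) (auto simp: inner_part_def)
      then show ?thesis
        using False Pair by (simp add: unfolding_op_def)
    qed
  qed
  have "integrable (lebesgue_on (\<Omega> \<times> refcell)) (unfolding_op \<Omega> \<epsilon> \<phi>)"
    using pm F_int by (simp add: integrable_restrict_space unfold)
  moreover have "(\<integral>x. \<phi> x \<partial>lebesgue_on (inner_part \<Omega> \<epsilon>)) =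
      1 / measure lebesgue refcell *
        (\<integral>z. unfolding_op \<Omega> \<epsilon> \<phi> z \<partial>lebesgue_on (\<Omega> \<times> refcell))"
  proof -
    have ip: "inner_part \<Omega> \<epsilon> \<in> sets lebesgue"
      using E cell_lmeasurable unfolding inner_part_def by (intro sets.finite_UN) auto
    have "(\<integral>x. \<phi> x \<partial>lebesgue_on (inner_part \<Omega> \<epsilon>)) = (LINT x:inner_part \<Omega> \<epsilon>|lebesgue. \<phi> x)"
      using ip by (simp add: integral_restrict_space set_lebesgue_integral_def)
    also have "\<dots> = (\<Sum>k\<in>?E. LINT x:cell \<epsilon> k|lebesgue. \<phi> x)"
      unfolding inner_part_def
    proof (rule set_integral_finite_UN_AE[OF E])
      show "AE x in lebesgue. x \<in> cell \<epsilon> i \<and> x \<in> cell \<epsilon> j \<longrightarrow> i = j" for i j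
        using ex1_cell[OF \<open>\<epsilon> > 0\<close>] by (intro AE_I2) blast
    qed (use \<phi>k cell_lmeasurable in auto)
    \<comment> \<open>Positivity of the volume of \<open>refcell\<close> allows the factor in
      \<open>F_integral\<close> to be cancelled.\<close>
    also have "\<dots> = 1 / measure lebesgue refcell * (\<Sum>k\<in>?E. integral\<^sup>L lebesgue (?F k))"
      using measure_refcell_pos by (simp add: F_integral sum_distrib_left)
    also have "(\<Sum>k\<in>?E. integral\<^sup>L lebesgue (?F k)) =
        (\<integral>z. unfolding_op \<Omega> \<epsilon> \<phi> z \<partial>lebesgue_on (\<Omega> \<times> refcell))"
      using pm F_int by (simp add: integral_restrict_space unfold)
    finally show ?thesis .
  qed
  ultimately show ?thesis ..
qed

end
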